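(* Let $a$ and $b$ be positive integers. All positive integer solutions of the equation $x^{2}-(a^{2}b^{2}-2b)y^{2}=1$ are given by $$(x_{n},y_{n})=\left(\tfrac{1}{2}V_{n}(2a^{2}b-2,-1),\;a\,U_{n}(2a^{2}b-2,-1)\right)$$ with $n\ge 1$.
   Context: For non-zero integers $k,s$ with $k^2+4s>0$, the generalized Fibonacci sequence is defined by $U_0(k,s)=0$, $U_1(k,s)=1$, $U_{n+1}(k,s)=kU_n(k,s)+sU_{n-1}(k,s)$ for $n\ge 1$, and the generalized Lucas sequence by $V_0(k,s)=2$, $V_1(k,s)=k$, $V_{n+1}(k,s)=kV_n(k,s)+sV_{n-1}(k,s)$ for $n\ge 1$. *)

theory Defs
  imports Complex_Main
begin

fun gen_fib :: "int \<Rightarrow> int \<Rightarrow> nat \<Rightarrow> int" where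
  "gen_fib k s 0 = 0"
| "gen_fib k s (Suc 0) = 1"
| "gen_fib k s (Suc (Suc n)) = k * gen_fib k s (Suc n) + s * gen_fib k s n"

fun gen_lucas :: "int \<Rightarrow> int \<Rightarrow> nat \<Rightarrow> int" where
  "gen_lucas k s 0 = 2"
| "gen_lucas k s (Suc 0) = k"
| "gen_lucas k s (Suc (Suc n)) = k * gen_lucas k s (Suc n) + s * gen_lucas k s n"

(* The recursions above are total in k and s; the generalized Fibonacci and Lucas
   sequences are considered only for parameters satisfying this predicate. *)
definition admissible :: "int \<Rightarrow> int \<Rightarrow> bool" where
  "admissible k s \<longleftrightarrow> k \<noteq> 0 \<and> s \<noteq> 0 \<and> k\<^sup>2 + 4 * s > 0"

end

theory Submission
  imports Defs
begin

text \<open>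
  With \<open>D = a\<^sup>2 b\<^sup>2 - 2 b\<close> and \<open>p = a\<^sup>2 b - 1\<close> the pair \<open>(p, a)\<close> solves the Pell equation.
  It is the smallest positive solution: for \<open>x = a b y - t\<close> with \<open>0 < y < a\<close> the equation reads
  \<open>t\<^sup>2 - 2 a b y t + 2 b y\<^sup>2 = 1\<close>, and the left-hand side minus the right-hand side decreases on
  \<open>1 \<le> t \<le> a b y\<close> from the negative value \<open>2 b y (y - a)\<close>.
  Multiplication by \<open>p - a \<surd>D\<close> then descends from any solution to the smallest one, while
  multiplication by \<open>p + a \<surd>D\<close> advances the index of the Lucas and Fibonacci sequences by one.
\<close>

text \<open>Read \<open>v/2 + u * sqrt (p^2 - 1)\<close> for a Lucas-Fibonacci pair: both equations
  together are multiplication by \<open>p + sqrt (p^2 - 1)\<close>, doubled to stay in the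
  integers.\<close>

lemma lucas_fib_Suc:
  "gen_lucas (2 * p) (-1) (Suc n)
     = p * gen_lucas (2 * p) (-1) n + 2 * (p\<^sup>2 - 1) * gen_fib (2 * p) (-1) n \<and>
   2 * gen_fib (2 * p) (-1) (Suc n)
     = 2 * p * gen_fib (2 * p) (-1) n + gen_lucas (2 * p) (-1) n"
proof (induction n)
  case 0
  show ?case by simp
next
  case (Suc n)
  define u v u' v' where "u = gen_fib (2 * p) (-1) n" and "v = gen_lucas (2 * p) (-1) n"
    and "u' = gen_fib (2 * p) (-1) (Suc n)" and "v' = gen_lucas (2 * p) (-1) (Suc n)"
  have IH: "v' = p * v + 2 * (p\<^sup>2 - 1) * u" "2 * u' = 2 * p * u + v"
    using Suc unfolding u_def v_def u'_def v'_def by auto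
  have "2 * p * v' - v = p * v' + 2 * (p\<^sup>2 - 1) * u'"
    using IH by algebra
  moreover have "2 * (2 * p * u' - u) = 2 * p * u' + v'"
    using IH by algebra
  ultimately show ?case
    by (simp add: u_def v_def u'_def v'_def)
qed

text \<open>The multiplier \<open>p + sqrt (p^2 - 1)\<close> has norm 1, so the norm keeps its value
  from index 0; the factor 4 clears the halves.\<close>

lemma lucas_fib_norm:
  "(gen_lucas (2 * p) (-1) n)\<^sup>2 - 4 * (p\<^sup>2 - 1) * (gen_fib (2 * p) (-1) n)\<^sup>2 = 4"
proof (induction n)
  case 0
  show ?case by simp
next
  case (Suc n)
  define u v where "u = gen_fib (2 * p) (-1) n" and "v = gen_lucas (2 * p) (-1) n"
  have "(gen_lucas (2 * p) (-1) (Suc n))\<^sup>2 - 4 * (p\<^sup>2 - 1) * (gen_fib (2 * p) (-1) (Suc n))\<^sup>2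
      = (gen_lucas (2 * p) (-1) (Suc n))\<^sup>2 - (p\<^sup>2 - 1) * (2 * gen_fib (2 * p) (-1) (Suc n))\<^sup>2"
    by algebra
  also have "\<dots> = (p * v + 2 * (p\<^sup>2 - 1) * u)\<^sup>2 - (p\<^sup>2 - 1) * (2 * p * u + v)\<^sup>2"
    by (simp only: lucas_fib_Suc u_def v_def)
  also have "\<dots> = v\<^sup>2 - 4 * (p\<^sup>2 - 1) * u\<^sup>2"
    by algebra
  finally show ?case
    using Suc by (simp add: u_def v_def)
qed

lemma even_gen_lucas: "even (gen_lucas (2 * p) (-1) n)"
  by (induction n) (use lucas_fib_Suc[of p] in auto)

text \<open>The defining recurrences subtract, so positivity is drawn from
  \<open>lucas_fib_Suc\<close>, whose coefficients are all positive here.\<close>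

lemma lucas_fib_pos:
  assumes "p > 1"
  shows "gen_lucas (2 * p) (-1) n > 0 \<and> gen_fib (2 * p) (-1) n \<ge> 0
           \<and> gen_fib (2 * p) (-1) (Suc n) > 0"
proof (induction n)
  case 0
  show ?case by simp
next
  case (Suc n)
  have p: "p\<^sup>2 - 1 > 0"
    using assms by (simp add: one_less_power)
  have "gen_lucas (2 * p) (-1) (Suc n) > 0"
    using Suc assms p lucas_fib_Suc[of p n] by (simp add: add_pos_nonneg)
  moreover from this have "2 * gen_fib (2 * p) (-1) (Suc (Suc n)) > 0"
    using Suc assms lucas_fib_Suc[of p "Suc n"] by (simp add: add_pos_pos)
  ultimately show ?case
    using Suc by simp
qed

text \<open>The two forms are the coordinates of \<open>(x + y * sqrt D) * (p - q * sqrt D)\<close>.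
  Each inequality compares two positive or nonnegative products through their squares, with the Pell
  equations giving the difference.\<close>

lemma pell_descent:
  fixes p q x y D :: int
  assumes "D > 0" and "p > 0" and "q > 0" and pq: "p\<^sup>2 - D * q\<^sup>2 = 1"
    and "x > 0" and "y > q" and xy: "x\<^sup>2 - D * y\<^sup>2 = 1"
  shows "p * x - D * q * y > 0" and "p * y - q * x > 0" and "p * y - q * x < y"
proof -
  have "(p * x)\<^sup>2 = (D * q * y)\<^sup>2 + (1 + D * q\<^sup>2 + D * y\<^sup>2)"
    using pq xy by algebra
  moreover have "1 + D * q\<^sup>2 + D * y\<^sup>2 > 0"
    using assms by (simp add: add_pos_nonneg)
  ultimately have "(D * q * y)\<^sup>2 < (p * x)\<^sup>2" by linarith
  then show "p * x - D * q * y > 0"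
    using assms by (smt (verit) power2_less_imp_less mult_pos_pos)
  have "(p * y)\<^sup>2 = (q * x)\<^sup>2 + (y\<^sup>2 - q\<^sup>2)"
    using pq xy by algebra
  moreover have "y\<^sup>2 > q\<^sup>2"
    using assms by (simp add: power_strict_mono)
  ultimately have "(q * x)\<^sup>2 < (p * y)\<^sup>2" by linarith
  then show "p * y - q * x > 0"
    using assms by (smt (verit) power2_less_imp_less mult_pos_pos)
  have "(q * x)\<^sup>2 = ((p - 1) * y)\<^sup>2 + (q\<^sup>2 + 2 * ((p - 1) * y\<^sup>2))"
    using pq xy by algebra
  moreover have "q\<^sup>2 + 2 * ((p - 1) * y\<^sup>2) > 0"
    using assms by (simp add: add_pos_nonneg)
  ultimately have "((p - 1) * y)\<^sup>2 < (q * x)\<^sup>2" by linarith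
  then have "(p - 1) * y < q * x"
    using assms by (smt (verit) power2_less_imp_less mult_pos_pos)
  then show "p * y - q * x < y"
    by (simp add: algebra_simps)
qed

lemma pell_solution_lucas_fib:
  fixes p q x y D :: int
  assumes "D > 0" and "p > 0" and "q > 0" and pq: "p\<^sup>2 - D * q\<^sup>2 = 1"
    and minimal: "\<And>u v. u > 0 \<Longrightarrow> v > 0 \<Longrightarrow> u\<^sup>2 - D * v\<^sup>2 = 1 \<Longrightarrow> q \<le> v"
    and "x > 0" and "y > 0" and "x\<^sup>2 - D * y\<^sup>2 = 1"
  shows "\<exists>n\<ge>1. gen_lucas (2 * p) (-1) n = 2 * x \<and> q * gen_fib (2 * p) (-1) n = y"
  using assms(6-8)
proof (induction "nat y" arbitrary: x y rule: less_induct)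
  case less
  show ?case
  proof (cases "y = q")
    case True
    then have "x\<^sup>2 = p\<^sup>2"
      using less.prems pq by simp
    then have "x = p"
      using less.prems \<open>p > 0\<close> by (simp add: power2_eq_iff_nonneg)
    then show ?thesis
      using True by (intro exI[of _ "1::nat"]) simp
  next
    case False
    then have "y > q"
      using minimal[OF less.prems] by simp
    define x' y' where "x' = p * x - D * q * y" and "y' = p * y - q * x"
    have "x' > 0" "y' > 0" "y' < y"
      using pell_descent[OF assms(1-4) \<open>x > 0\<close> \<open>y > q\<close> less.prems(3)]
      unfolding x'_def y'_def by auto
    moreover have "x'\<^sup>2 - D * y'\<^sup>2 = 1"
      using pq less.prems(3) unfolding x'_def y'_def by algebra
    ultimately obtain n where n: "gen_lucas (2 * p) (-1) n = 2 * x'"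
        "q * gen_fib (2 * p) (-1) n = y'"
      using less.hyps[of y' x'] by auto
    \<comment> \<open>Multiplying \<open>x' + y' * sqrt D\<close> by \<open>p + q * sqrt D\<close>
      undoes the descent; \<open>D * q^2 = p^2 - 1\<close> matches this with the index
      shift.\<close>
    have "gen_lucas (2 * p) (-1) (Suc n) = 2 * x"
      using n lucas_fib_Suc[of p n] pq unfolding x'_def y'_def by algebra
    moreover have "2 * (q * gen_fib (2 * p) (-1) (Suc n)) = 2 * y"
      using n lucas_fib_Suc[of p n] pq unfolding x'_def y'_def by algebra
    ultimately show ?thesis
      by (intro exI[of _ "Suc n"]) simp
  qed
qed

lemma pell_minimal_solution:
  fixes a b x y :: int
  assumes "a > 0" and "b > 0" and "x > 0" and "y > 0"
    and eq: "x\<^sup>2 - (a\<^sup>2 * b\<^sup>2 - 2 * b) * y\<^sup>2 = 1"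
  shows "a \<le> y"
proof (rule ccontr)
  assume "\<not> a \<le> y"
  then have "y < a" by simp
  define t where "t = a * b * y - x"
  have t: "t\<^sup>2 - 1 = 2 * b * y * (a * t - y)"
    using eq unfolding t_def by algebra
  have "b * y\<^sup>2 \<ge> 1"
    using assms by (simp add: int_one_le_iff_zero_less)
  then have "x\<^sup>2 < (a * b * y)\<^sup>2"
    using eq by (simp add: algebra_simps)
  then have "t \<ge> 1"
    using assms unfolding t_def by (smt (verit) power2_less_imp_less mult_pos_pos)
  \<comment> \<open>For \<open>f(t) = t^2 - 2 * a * b * y * t\<close> this product is
    \<open>f(1) - f(t)\<close>, which turns the monotonicity argument into a sign of factors. The
    second factor is \<open>a * b * y + x - 1\<close>.\<close>
  have "(t - 1) * (2 * (a * b * y) - t - 1) \<ge> 0"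
    using \<open>t \<ge> 1\<close> \<open>x > 0\<close> by (intro mult_nonneg_nonneg) (auto simp: t_def)
  moreover have "(t - 1) * (2 * (a * b * y) - t - 1) = 2 * (b * y * (y - a))"
    using t by algebra
  moreover have "b * y * (y - a) < 0"
    using assms \<open>y < a\<close> by (simp add: mult_pos_neg)
  ultimately show False by linarith
qed

theorem theorem10:
  fixes a b :: int
  assumes "a > 0" and "b > 0"
    and "admissible (2 * a\<^sup>2 * b - 2) (-1)"
  shows "{(rat_of_int x, rat_of_int y) | x y :: int.
            x > 0 \<and> y > 0 \<and> x\<^sup>2 - (a\<^sup>2 * b\<^sup>2 - 2 * b) * y\<^sup>2 = 1}
       = {(1 / 2 * rat_of_int (gen_lucas (2 * a\<^sup>2 * b - 2) (-1) n),
           rat_of_int (a * gen_fib (2 * a\<^sup>2 * b - 2) (-1) n)) | n :: nat. n \<ge> 1}"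
    (is "?L = ?R")
proof -
  define p D where "p = a\<^sup>2 * b - 1" and "D = a\<^sup>2 * b\<^sup>2 - 2 * b"
  have k: "2 * a\<^sup>2 * b - 2 = 2 * p"
    unfolding p_def by simp
  have "a\<^sup>2 * b > 0"
    using assms by simp
  \<comment> \<open>The discriminant condition reads \<open>4 * p^2 - 4 > 0\<close>. It excludes
    \<open>a^2 * b\<close> equal to 1 or 2, where \<open>D\<close> would not be positive.\<close>
  moreover have "p\<^sup>2 > 1"
    using assms(3) unfolding k admissible_def by (simp add: power_mult_distrib)
  ultimately have "p > 1"
    unfolding p_def by (smt (verit) power2_eq_square mult_eq_0_iff one_power2)
  have pa: "p\<^sup>2 - D * a\<^sup>2 = 1"
    unfolding p_def D_def by algebra
  have "D = b * (p - 1)"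
    unfolding p_def D_def by algebra
  then have "D > 0"
    using \<open>p > 1\<close> \<open>b > 0\<close> by simp
  have "?L \<subseteq> ?R"
  proof clarify
    fix x y :: int
    assume xy: "x > 0" "y > 0" "x\<^sup>2 - (a\<^sup>2 * b\<^sup>2 - 2 * b) * y\<^sup>2 = 1"
    have "\<exists>n\<ge>1. gen_lucas (2 * p) (-1) n = 2 * x \<and> a * gen_fib (2 * p) (-1) n = y"
    proof (rule pell_solution_lucas_fib[OF \<open>D > 0\<close> _ \<open>a > 0\<close> pa])
      show "a \<le> v" if "u > 0" "v > 0" "u\<^sup>2 - D * v\<^sup>2 = 1" for u v
        using pell_minimal_solution[OF assms(1,2)] that unfolding D_def by blast
    qed (use \<open>p > 1\<close> xy in \<open>auto simp: D_def\<close>)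
    then obtain n where "n \<ge> 1" "gen_lucas (2 * p) (-1) n = 2 * x"
        "a * gen_fib (2 * p) (-1) n = y"
      by blast
    then show "\<exists>n. (rat_of_int x, rat_of_int y)
        = (1 / 2 * rat_of_int (gen_lucas (2 * a\<^sup>2 * b - 2) (-1) n),
           rat_of_int (a * gen_fib (2 * a\<^sup>2 * b - 2) (-1) n)) \<and> n \<ge> 1"
      unfolding k by (intro exI[of _ n]) auto
  qed
  moreover have "?R \<subseteq> ?L"
  proof clarify
    fix n :: nat
    assume "n \<ge> 1"
    \<comment> \<open>\<open>lucas_fib_pos\<close> makes the Fibonacci term strictly positive only
      at a successor index, so it is also applied at \<open>m\<close>.\<close>
    then obtain m where m: "n = Suc m"
      by (cases n) auto
    define u where "u = gen_fib (2 * p) (-1) n"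
    obtain x where x: "gen_lucas (2 * p) (-1) n = 2 * x"
      using even_gen_lucas by blast
    have "x > 0" "u > 0"
      using lucas_fib_pos[OF \<open>p > 1\<close>, of n] lucas_fib_pos[OF \<open>p > 1\<close>, of m] x m
      unfolding u_def by auto
    have "4 * (x\<^sup>2 - D * (a * u)\<^sup>2) = (2 * x)\<^sup>2 - 4 * (p\<^sup>2 - 1) * u\<^sup>2"
      using pa by algebra
    also have "\<dots> = 4"
      using lucas_fib_norm[of p n] unfolding x u_def .
    finally have "x\<^sup>2 - D * (a * u)\<^sup>2 = 1"
      by presburger
    then have "x\<^sup>2 - (a\<^sup>2 * b\<^sup>2 - 2 * b) * (a * u)\<^sup>2 = 1"
      unfolding D_def .
    then show "\<exists>x y. (1 / 2 * rat_of_int (gen_lucas (2 * a\<^sup>2 * b - 2) (-1) n),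
           rat_of_int (a * gen_fib (2 * a\<^sup>2 * b - 2) (-1) n)) = (rat_of_int x, rat_of_int y) \<and>
           x > 0 \<and> y > 0 \<and> x\<^sup>2 - (a\<^sup>2 * b\<^sup>2 - 2 * b) * y\<^sup>2 = 1"
      using \<open>x > 0\<close> \<open>u > 0\<close> \<open>a > 0\<close> unfolding k x u_def[symmetric]
      by (intro exI[of _ x] exI[of _ "a * u"]) simp
  qed
  ultimately show ?thesis by (rule subset_antisym)
qed

end
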